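(* Let $(G,N,\odot)$ be a reduced skew bracoid and let $A=\lambda_\odot(G)\subseteq\mathrm{Hol}(N)$. The following are equivalent: (i) $A$ is of the form $N\rtimes B$ for some subgroup $B$ of $\mathrm{Aut}(N)$; (ii) $A$ contains $(N,\mathrm{id})=\{(\eta,\mathrm{id}):\eta\in N\}$; (iii) the skew bracoid $(G,N,\odot)$ is almost classical.
   Context: A skew bracoid $(G,\cdot,N,\star,\odot)$, written $(G,N,\odot)$, consists of two groups $(G,\cdot)$ and $(N,\star)$ and a transitive action $\odot$ of $G$ on the set $N$ such that $g\odot(\eta_1\star\eta_2)=(g\odot\eta_1)\star(g\odot e_N)^{-1}\star(g\odot\eta_2)$ for all $g\in G$, $\eta_1,\eta_2\in N$. It is reduced if the action $\odot$ is faithful. It is almost classical if $S=\mathrm{Stab}_G(e_N)$ has a normal complement $H$ in $G$ (i.e. $H$ is a normal subgroup of $G$ with $G=HS$ and $H\cap S$ trivial) such that $(h_1\odot e_N)\star(h_2\odot e_N)=h_1h_2\odot e_N$ for all $h_1,h_2\in H$. $\mathrm{Hol}(N)=N\rtimes\mathrm{Aut}(N)$ with product $(\eta_1,\theta_1)(\eta_2,\theta_2)=(\eta_1\theta_1(\eta_2),\theta_1\theta_2)$, acting on the set $N$ by $(\eta,\theta)\mu=\eta\theta(\mu)$; in (i), $N$ and $\mathrm{Aut}(N)$ are identified with the subgroups $\{(\eta,\mathrm{id})\}$ and $\{(e_N,\theta)\}$ of $\mathrm{Hol}(N)$. The map $\gamma:G\to\mathrm{Aut}(N)$ is the homomorphism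 $\gamma(g)(\eta)=(g\odot e_N)^{-1}\star(g\odot\eta)$, and $\lambda_\odot:G\to\mathrm{Hol}(N)$ is the homomorphism $g\mapsto(g\odot e_N,\gamma(g))$. *)

theory Defs
  imports "HOL-Algebra.Group_Action"
begin

text \<open>
  That \<open>G\<close> is a group and that \<open>act\<close> is an action of it on the set \<open>carrier N\<close> are part of
  \<^locale>\<open>transitive_action\<close>, where actions are homomorphisms into \<^term>\<open>BijGroup (carrier N)\<close>.
\<close>

locale skew_bracoid = transitive_action G "carrier N" act + N: group N
  for G (structure) and N and act +
  assumes act_mult:
    "\<lbrakk>g \<in> carrier G; x \<in> carrier N; y \<in> carrier N\<rbrakk> \<Longrightarrow>
      act g (x \<otimes>\<^bsub>N\<^esub> y) = act g x \<otimes>\<^bsub>N\<^esub> inv\<^bsub>N\<^esub> (act g \<one>\<^bsub>N\<^esub>) \<otimes>\<^bsub>N\<^esub> act g y"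

locale reduced_skew_bracoid = skew_bracoid G N act + faithful_action G "carrier N" act
  for G (structure) and N and act

text \<open>
  The term \<open>normal_complement G S H\<close> also says that \<open>G\<close> is the internal semidirect product of the
  normal subgroup \<open>H\<close> by the subgroup \<open>S\<close>.
\<close>

definition normal_complement :: "('a, 'c) monoid_scheme \<Rightarrow> 'a set \<Rightarrow> 'a set \<Rightarrow> bool" where
  "normal_complement G S H \<longleftrightarrow>
     subgroup S G \<and> H \<lhd> G \<and> carrier G = H <#>\<^bsub>G\<^esub> S \<and> H \<inter> S = {\<one>\<^bsub>G\<^esub>}"

definition almost_classical ::
    "('a, 'c) monoid_scheme \<Rightarrow> ('b, 'd) monoid_scheme \<Rightarrow> ('a \<Rightarrow> 'b \<Rightarrow> 'b) \<Rightarrow> bool" where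
  "almost_classical G N act \<longleftrightarrow>
     (\<exists>H. normal_complement G (stabilizer G act \<one>\<^bsub>N\<^esub>) H \<and>
          (\<forall>h1\<in>H. \<forall>h2\<in>H. act h1 \<one>\<^bsub>N\<^esub> \<otimes>\<^bsub>N\<^esub> act h2 \<one>\<^bsub>N\<^esub> = act (h1 \<otimes>\<^bsub>G\<^esub> h2) \<one>\<^bsub>N\<^esub>))"

definition Hol :: "('b, 'd) monoid_scheme \<Rightarrow> ('b \<times> ('b \<Rightarrow> 'b)) monoid" where
  "Hol N =
     \<lparr>carrier = carrier N \<times> carrier (AutoGroup N),
      mult = \<lambda>(x, s) (y, t). (x \<otimes>\<^bsub>N\<^esub> s y, s \<otimes>\<^bsub>AutoGroup N\<^esub> t),
      one = (\<one>\<^bsub>N\<^esub>, \<one>\<^bsub>AutoGroup N\<^esub>)\<rparr>"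

definition Hol_N :: "('b, 'd) monoid_scheme \<Rightarrow> ('b \<times> ('b \<Rightarrow> 'b)) set" where
  "Hol_N N = carrier N \<times> {\<one>\<^bsub>AutoGroup N\<^esub>}"

definition Hol_Aut :: "('b, 'd) monoid_scheme \<Rightarrow> ('b \<Rightarrow> 'b) set \<Rightarrow> ('b \<times> ('b \<Rightarrow> 'b)) set" where
  "Hol_Aut N B = {\<one>\<^bsub>N\<^esub>} \<times> B"

text \<open>The restriction makes the values elements of \<^term>\<open>AutoGroup N\<close>, which are extensional.\<close>

definition gamma :: "('b, 'd) monoid_scheme \<Rightarrow> ('a \<Rightarrow> 'b \<Rightarrow> 'b) \<Rightarrow> 'a \<Rightarrow> 'b \<Rightarrow> 'b" where
  "gamma N act g = (\<lambda>x\<in>carrier N. inv\<^bsub>N\<^esub> (act g \<one>\<^bsub>N\<^esub>) \<otimes>\<^bsub>N\<^esub> act g x)"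

definition lambda_act :: "('b, 'd) monoid_scheme \<Rightarrow> ('a \<Rightarrow> 'b \<Rightarrow> 'b) \<Rightarrow> 'a \<Rightarrow> 'b \<times> ('b \<Rightarrow> 'b)" where
  "lambda_act N act g = (act g \<one>\<^bsub>N\<^esub>, gamma N act g)"

text \<open>
  \<open>A = N \<rtimes> B\<close> inside \<open>Hol N\<close>, where \<open>N\<close> and \<open>B\<close> are identified with their images in \<open>Hol N\<close>.
\<close>

definition is_N_semidirect ::
    "('b, 'd) monoid_scheme \<Rightarrow> ('b \<times> ('b \<Rightarrow> 'b)) set \<Rightarrow> ('b \<Rightarrow> 'b) set \<Rightarrow> bool" where
  "is_N_semidirect N A B \<longleftrightarrow>
     subgroup A (Hol N) \<and> normal_complement (Hol N\<lparr>carrier := A\<rparr>) (Hol_Aut N B) (Hol_N N)"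

end

theory Submission
  imports Defs
begin

text \<open>
  Write \<open>e\<close> for the identity of \<open>N\<close>. Everything rests on the factorisation
  \<open>g \<odot> x = (g \<odot> e) \<star> \<gamma>(g)(x)\<close>, which says that \<open>g\<close> acts on \<open>N\<close> in the same way as \<open>\<lambda>(g) \<in> Hol N\<close>.

  Conditions (i) and (ii) are equivalent for every subgroup \<open>A\<close> of \<open>Hol N\<close>: the copy of \<open>N\<close> in
  \<open>Hol N\<close> is the kernel of the projection to \<open>Aut N\<close>, so it is normal, and once \<open>A\<close> contains it,
  each \<open>(\<eta>, \<theta>) \<in> A\<close> splits inside \<open>A\<close> as \<open>(\<eta>, id)(e, \<theta>)\<close>. The image of \<open>\<lambda>\<close> is such a subgroup,
  because \<open>\<lambda>\<close> is a homomorphism.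

  Conditions (ii) and (iii) are linked by the normal subgroup \<open>ker \<gamma>\<close>, the preimage of the copy of
  \<open>N\<close> under \<open>\<lambda>\<close>. An element of \<open>ker \<gamma>\<close> acts as the left translation by \<open>g \<odot> e\<close>. Hence
  \<open>ker \<gamma>\<close> always satisfies the multiplicativity condition of an almost classical skew bracoid, and
  faithfulness makes it meet the stabiliser of \<open>e\<close> trivially. What (ii) adds is that every
  translation occurs, that is, \<open>ker \<gamma>\<close> is transitive on \<open>N\<close>, which means that \<open>ker \<gamma>\<close> and the
  stabiliser of \<open>e\<close> generate \<open>G\<close>. Conversely, let \<open>H\<close> be a normal complement as in (iii). It is
  transitive on \<open>N\<close>, and multiplicativity says that \<open>\<gamma>(h)\<close> fixes each \<open>k \<odot> e\<close> with \<open>k \<in> H\<close>. So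
  \<open>\<gamma>(h) = id\<close>, and the elements \<open>\<lambda>(h) = (h \<odot> e, id)\<close> exhaust the copy of \<open>N\<close>.
\<close>

section \<open>The holomorph\<close>

lemma carrier_AutoGroup: "carrier (AutoGroup N) = auto N"
  by (simp add: AutoGroup_def)

lemma one_AutoGroup: "\<one>\<^bsub>AutoGroup N\<^esub> = (\<lambda>x\<in>carrier N. x)"
  by (simp add: AutoGroup_def BijGroup_def)

lemma mult_AutoGroup:
  "\<lbrakk>s \<in> auto N; t \<in> auto N\<rbrakk> \<Longrightarrow> s \<otimes>\<^bsub>AutoGroup N\<^esub> t = compose (carrier N) s t"
  by (simp add: AutoGroup_def BijGroup_def auto_def)

lemma auto_closed: "\<lbrakk>s \<in> auto N; x \<in> carrier N\<rbrakk> \<Longrightarrow> s x \<in> carrier N"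
  by (auto simp: auto_def hom_def)

lemma auto_mult:
  "\<lbrakk>s \<in> auto N; x \<in> carrier N; y \<in> carrier N\<rbrakk> \<Longrightarrow> s (x \<otimes>\<^bsub>N\<^esub> y) = s x \<otimes>\<^bsub>N\<^esub> s y"
  by (auto simp: auto_def hom_def)

lemma (in group) auto_one: "s \<in> auto G \<Longrightarrow> s \<one> = \<one>"
  using hom_one[of s G G] is_group by (auto simp: auto_def)

lemma carrier_Hol: "carrier (Hol N) = carrier N \<times> auto N"
  by (simp add: Hol_def carrier_AutoGroup)

lemma one_Hol: "\<one>\<^bsub>Hol N\<^esub> = (\<one>\<^bsub>N\<^esub>, \<one>\<^bsub>AutoGroup N\<^esub>)"
  by (simp add: Hol_def)

lemma mult_Hol: "(x, s) \<otimes>\<^bsub>Hol N\<^esub> (y, t) = (x \<otimes>\<^bsub>N\<^esub> s y, s \<otimes>\<^bsub>AutoGroup N\<^esub> t)"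
  by (simp add: Hol_def)

context group
begin

lemma group_Hol: "group (Hol G)"
proof -
  interpret Aut: group "AutoGroup G"
    by (rule AutoGroup)
  note Aut_simps = carrier_AutoGroup[of G]
  show ?thesis
  proof (rule groupI)
    fix p q assume "p \<in> carrier (Hol G)" "q \<in> carrier (Hol G)"
    then show "p \<otimes>\<^bsub>Hol G\<^esub> q \<in> carrier (Hol G)"
      using Aut.m_closed by (auto simp: carrier_Hol mult_Hol Aut_simps auto_closed)
  next
    show "\<one>\<^bsub>Hol G\<^esub> \<in> carrier (Hol G)"
      using Aut.one_closed by (simp add: carrier_Hol one_Hol Aut_simps)
  next
    fix p q r assume "p \<in> carrier (Hol G)" "q \<in> carrier (Hol G)" "r \<in> carrier (Hol G)"
    then show "p \<otimes>\<^bsub>Hol G\<^esub> q \<otimes>\<^bsub>Hol G\<^esub> r = p \<otimes>\<^bsub>Hol G\<^esub> (q \<otimes>\<^bsub>Hol G\<^esub> r)"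
      using Aut.m_assoc
      by (auto simp: carrier_Hol mult_Hol Aut_simps auto_closed auto_mult m_assoc
          mult_AutoGroup[of _ G] compose_eq)
  next
    fix p assume "p \<in> carrier (Hol G)"
    then show "\<one>\<^bsub>Hol G\<^esub> \<otimes>\<^bsub>Hol G\<^esub> p = p"
      using Aut.l_one by (auto simp: carrier_Hol mult_Hol one_Hol one_AutoGroup Aut_simps)
  next
    fix p assume "p \<in> carrier (Hol G)"
    then obtain x s where p: "p = (x, s)" and x: "x \<in> carrier G" and s: "s \<in> auto G"
      by (auto simp: carrier_Hol)
    define t where "t = inv\<^bsub>AutoGroup G\<^esub> s"
    have t: "t \<in> auto G" and ts: "t \<otimes>\<^bsub>AutoGroup G\<^esub> s = \<one>\<^bsub>AutoGroup G\<^esub>"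
      using s Aut.inv_closed Aut.l_inv by (auto simp: t_def Aut_simps)
    have "(t (inv x), t) \<otimes>\<^bsub>Hol G\<^esub> p = \<one>\<^bsub>Hol G\<^esub>"
      using auto_mult[OF t, of "inv x" x] x ts
      by (simp add: p mult_Hol one_Hol auto_one[OF t])
    then show "\<exists>q\<in>carrier (Hol G). q \<otimes>\<^bsub>Hol G\<^esub> p = \<one>\<^bsub>Hol G\<^esub>"
      using t x by (intro bexI) (auto simp: carrier_Hol auto_closed)
  qed
qed

lemma snd_Hol_hom: "group_hom (Hol G) (AutoGroup G) snd"
  by (rule group_hom.intro[OF group_Hol AutoGroup])
     (auto simp: group_hom_axioms_def hom_def carrier_Hol carrier_AutoGroup mult_Hol)

lemma kernel_snd_Hol: "kernel (Hol G) (AutoGroup G) snd = Hol_N G"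
  using group.is_monoid[OF AutoGroup] monoid.one_closed
  by (fastforce simp: kernel_def Hol_N_def carrier_Hol carrier_AutoGroup)

lemma Hol_N_normal: "Hol_N G \<lhd> Hol G"
  using group_hom.normal_kernel[OF snd_Hol_hom] by (simp add: kernel_snd_Hol)

lemma Pair_one_Hol_hom: "group_hom (AutoGroup G) (Hol G) (Pair \<one>)"
  by (rule group_hom.intro[OF AutoGroup group_Hol])
     (auto simp: group_hom_axioms_def hom_def carrier_Hol carrier_AutoGroup mult_Hol auto_one)

lemma Hol_N_mult_Hol_Aut:
  assumes "x \<in> carrier G" "s \<in> auto G"
  shows "(x, \<one>\<^bsub>AutoGroup G\<^esub>) \<otimes>\<^bsub>Hol G\<^esub> (\<one>, s) = (x, s)"
  using assms monoid.l_one[OF group.is_monoid[OF AutoGroup], of s]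
  by (simp add: mult_Hol one_AutoGroup carrier_AutoGroup)

end

lemma (in group_hom) subgroup_vimage:
  assumes "subgroup K H"
  shows "subgroup {x \<in> carrier G. h x \<in> K} G"
proof -
  interpret K: subgroup K H by (rule assms)
  show ?thesis
    by (rule subgroup.intro) auto
qed

text \<open>
  The complement of \<open>N\<close> in \<open>A\<close> is forced to be the intersection of \<open>A\<close> with the copy of \<open>Aut N\<close>. It is
  a complement because \<open>(\<eta>, \<theta>) = (\<eta>, id)(e, \<theta>)\<close> and the first factor lies in \<open>A\<close> by hypothesis.
\<close>

lemma (in group) is_N_semidirect_iff:
  assumes A: "subgroup A (Hol G)"
  shows "(\<exists>B. subgroup B (AutoGroup G) \<and> is_N_semidirect G A B) \<longleftrightarrow> Hol_N G \<subseteq> A"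
proof
  assume "\<exists>B. subgroup B (AutoGroup G) \<and> is_N_semidirect G A B"
  then have "subgroup (Hol_N G) (Hol G\<lparr>carrier := A\<rparr>)"
    by (auto simp: is_N_semidirect_def normal_complement_def dest: normal_imp_subgroup)
  then show "Hol_N G \<subseteq> A"
    using subgroup.subset by fastforce
next
  assume N: "Hol_N G \<subseteq> A"
  define B where "B = {s \<in> carrier (AutoGroup G). (\<one>, s) \<in> A}"
  interpret Hol: group "Hol G" by (rule group_Hol)
  have B: "subgroup B (AutoGroup G)"
    unfolding B_def by (rule group_hom.subgroup_vimage[OF Pair_one_Hol_hom A])
  have BA: "Hol_Aut G B \<subseteq> A"
    by (auto simp: Hol_Aut_def B_def)
  have "Hol_Aut G B = Pair \<one> ` B"
    by (auto simp: Hol_Aut_def)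
  then have "subgroup (Hol_Aut G B) (Hol G)"
    using group_hom.subgroup_img_is_subgroup[OF Pair_one_Hol_hom B] by simp
  then have 1: "subgroup (Hol_Aut G B) (Hol G\<lparr>carrier := A\<rparr>)"
    using A BA by (simp add: Hol.subgroup_incl)
  have 2: "Hol_N G \<lhd> Hol G\<lparr>carrier := A\<rparr>"
    using Hol.normal_restrict_supergroup[OF A Hol_N_normal N] .
  have "A \<subseteq> Hol_N G <#>\<^bsub>Hol G\<^esub> Hol_Aut G B"
  proof
    fix p assume pA: "p \<in> A"
    then obtain x s where p: "p = (x, s)" and x: "x \<in> carrier G" and s: "s \<in> auto G"
      using subgroup.subset[OF A] by (auto simp: carrier_Hol)
    have xN: "(x, \<one>\<^bsub>AutoGroup G\<^esub>) \<in> Hol_N G"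
      using x by (simp add: Hol_N_def)
    have p_eq: "(x, \<one>\<^bsub>AutoGroup G\<^esub>) \<otimes>\<^bsub>Hol G\<^esub> (\<one>, s) = p"
      unfolding p using x s by (rule Hol_N_mult_Hol_Aut)
    have carr: "(x, \<one>\<^bsub>AutoGroup G\<^esub>) \<in> carrier (Hol G)" "(\<one>, s) \<in> carrier (Hol G)"
      using subgroup.subset[OF A] N xN s by (auto simp: carrier_Hol)
    have "(\<one>, s) = inv\<^bsub>Hol G\<^esub> (x, \<one>\<^bsub>AutoGroup G\<^esub>) \<otimes>\<^bsub>Hol G\<^esub> p"
      unfolding p_eq[symmetric] using carr by (simp add: Hol.m_assoc[symmetric])
    then have "(\<one>, s) \<in> A"
      using subgroup.m_closed[OF A subgroup.m_inv_closed[OF A] pA] N xN by (metis subsetD)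
    then have "(\<one>, s) \<in> Hol_Aut G B"
      using s by (simp add: Hol_Aut_def B_def carrier_AutoGroup)
    then show "p \<in> Hol_N G <#>\<^bsub>Hol G\<^esub> Hol_Aut G B"
      using xN p_eq unfolding set_mult_def by blast
  qed
  moreover have "Hol_N G <#>\<^bsub>Hol G\<^esub> Hol_Aut G B \<subseteq> A"
    using N BA subgroup.m_closed[OF A] unfolding set_mult_def by blast
  ultimately have 3: "A = Hol_N G <#>\<^bsub>Hol G\<^esub> Hol_Aut G B"
    by blast
  have 4: "Hol_N G \<inter> Hol_Aut G B = {\<one>\<^bsub>Hol G\<^esub>}"
    using subgroup.one_closed[OF B] by (auto simp: Hol_N_def Hol_Aut_def one_Hol)
  have "is_N_semidirect G A B"
    unfolding is_N_semidirect_def normal_complement_def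
    using A 1 2 3 4 by (simp add: set_mult_def)
  with B show "\<exists>B. subgroup B (AutoGroup G) \<and> is_N_semidirect G A B"
    by blast
qed

section \<open>The homomorphisms to the automorphism group and to the holomorph\<close>

context skew_bracoid
begin

lemma group_G: "group G"
  using group_hom group_hom.axioms(1) by blast

lemma act_closed: "\<lbrakk>g \<in> carrier G; x \<in> carrier N\<rbrakk> \<Longrightarrow> act g x \<in> carrier N"
  using element_image by blast

lemma gamma_eq:
  "x \<in> carrier N \<Longrightarrow> gamma N act g x = inv\<^bsub>N\<^esub> (act g \<one>\<^bsub>N\<^esub>) \<otimes>\<^bsub>N\<^esub> act g x"
  by (simp add: gamma_def)

lemma act_eq_gamma:
  "\<lbrakk>g \<in> carrier G; x \<in> carrier N\<rbrakk> \<Longrightarrow> act g x = act g \<one>\<^bsub>N\<^esub> \<otimes>\<^bsub>N\<^esub> gamma N act g x"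
  by (simp add: gamma_eq act_closed N.m_assoc[symmetric])

lemma gamma_auto:
  assumes g: "g \<in> carrier G"
  shows "gamma N act g \<in> auto N"
proof -
  let ?c = "gamma N act g"
  have closed: "?c x \<in> carrier N" if "x \<in> carrier N" for x
    using g that by (simp add: gamma_eq act_closed)
  have "?c \<in> hom N N"
  proof (rule homI)
    fix x y assume "x \<in> carrier N" "y \<in> carrier N"
    then show "?c (x \<otimes>\<^bsub>N\<^esub> y) = ?c x \<otimes>\<^bsub>N\<^esub> ?c y"
      using g by (simp add: gamma_eq act_mult act_closed N.m_assoc)
  qed (rule closed)
  moreover have "inj_on ?c (carrier N)"
    using inj_prop[OF g] g by (auto simp: inj_on_def gamma_eq act_closed)
  moreover have "?c ` carrier N = carrier N"
  proof
    show "carrier N \<subseteq> ?c ` carrier N"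
    proof
      fix y assume y: "y \<in> carrier N"
      then obtain x where x: "x \<in> carrier N" "act g x = act g \<one>\<^bsub>N\<^esub> \<otimes>\<^bsub>N\<^esub> y"
        using bij_prop1[OF g, of "act g \<one>\<^bsub>N\<^esub> \<otimes>\<^bsub>N\<^esub> y"] g by (auto simp: act_closed)
      then have "?c x = y"
        using g y by (simp add: gamma_eq act_closed N.m_assoc[symmetric])
      with x show "y \<in> ?c ` carrier N" by blast
    qed
  qed (use closed in auto)
  ultimately show ?thesis
    by (simp add: auto_def Bij_def bij_betw_def) (simp add: gamma_def)
qed

lemma gamma_mult:
  assumes g: "g \<in> carrier G" and h: "h \<in> carrier G"
  shows "gamma N act (g \<otimes> h) = gamma N act g \<otimes>\<^bsub>AutoGroup N\<^esub> gamma N act h"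
proof -
  interpret G: group G by (rule group_G)
  have "gamma N act (g \<otimes> h) x = gamma N act g (gamma N act h x)" if x: "x \<in> carrier N" for x
  proof -
    let ?a = "act g \<one>\<^bsub>N\<^esub>" and ?b = "act h \<one>\<^bsub>N\<^esub>"
    note gh = act_closed[OF g] act_closed[OF h] auto_closed[OF gamma_auto[OF g]]
      auto_closed[OF gamma_auto[OF h]]
    have "act (g \<otimes> h) x = act g (?b \<otimes>\<^bsub>N\<^esub> gamma N act h x)"
      using x g h by (simp add: composition_rule act_eq_gamma[symmetric])
    also have "\<dots> = ?a \<otimes>\<^bsub>N\<^esub> gamma N act g (?b \<otimes>\<^bsub>N\<^esub> gamma N act h x)"
      using x gh by (intro act_eq_gamma[OF g]) simp
    also have "\<dots> = ?a \<otimes>\<^bsub>N\<^esub> gamma N act g ?b \<otimes>\<^bsub>N\<^esub> gamma N act g (gamma N act h x)"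
      using x gh by (simp add: auto_mult[OF gamma_auto[OF g]] N.m_assoc)
    also have "?a \<otimes>\<^bsub>N\<^esub> gamma N act g ?b = act (g \<otimes> h) \<one>\<^bsub>N\<^esub>"
      using gh g h by (simp add: composition_rule act_eq_gamma[symmetric])
    finally have "act (g \<otimes> h) x = act (g \<otimes> h) \<one>\<^bsub>N\<^esub> \<otimes>\<^bsub>N\<^esub> gamma N act g (gamma N act h x)" .
    then show ?thesis
      using x gh g h by (simp add: gamma_eq[OF x] act_closed N.m_assoc[symmetric])
  qed
  then have "gamma N act (g \<otimes> h) = compose (carrier N) (gamma N act g) (gamma N act h)"
    by (intro extensionalityI[of _ "carrier N"]) (simp_all add: compose_eq, simp add: gamma_def)
  then show ?thesis
    using g h by (simp add: mult_AutoGroup gamma_auto)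
qed

lemma gamma_group_hom: "group_hom G (AutoGroup N) (gamma N act)"
  by (rule group_hom.intro[OF group_G N.AutoGroup])
     (auto simp: group_hom_axioms_def hom_def carrier_AutoGroup gamma_auto gamma_mult)

lemma lambda_act_group_hom: "group_hom G (Hol N) (lambda_act N act)"
proof (rule group_hom.intro[OF group_G N.group_Hol])
  show "group_hom_axioms G (Hol N) (lambda_act N act)"
    by (auto simp: group_hom_axioms_def hom_def carrier_Hol lambda_act_def gamma_auto act_closed
        mult_Hol gamma_mult composition_rule act_eq_gamma[symmetric])
qed

lemma gamma_trivial_act:
  assumes "g \<in> carrier G" "gamma N act g = \<one>\<^bsub>AutoGroup N\<^esub>" "x \<in> carrier N"
  shows "act g x = act g \<one>\<^bsub>N\<^esub> \<otimes>\<^bsub>N\<^esub> x"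
  using act_eq_gamma[OF assms(1,3)] assms by (simp add: one_AutoGroup)

section \<open>Almost classical skew bracoids\<close>

text \<open>
  A complement \<open>H\<close> of the stabiliser of \<open>e\<close> is transitive on \<open>N\<close>: if \<open>g = h s\<close> with \<open>s\<close> in the
  stabiliser, then \<open>g\<close> and \<open>h\<close> move \<open>e\<close> to the same point. Multiplicativity on the orbit of \<open>e\<close>
  therefore determines how \<open>H\<close> acts on all of \<open>N\<close>.
\<close>

lemma almost_classical_imp_Hol_N_subset:
  assumes "almost_classical G N act"
  shows "Hol_N N \<subseteq> lambda_act N act ` carrier G"
proof -
  let ?S = "stabilizer G act \<one>\<^bsub>N\<^esub>"
  obtain H where H: "subgroup H G" and GHS: "carrier G = H <#> ?S"
    and mult: "\<And>h k. \<lbrakk>h \<in> H; k \<in> H\<rbrakk> \<Longrightarrow> act h \<one>\<^bsub>N\<^esub> \<otimes>\<^bsub>N\<^esub> act k \<one>\<^bsub>N\<^esub> = act (h \<otimes> k) \<one>\<^bsub>N\<^esub>"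
    using assms unfolding almost_classical_def normal_complement_def
    by (blast dest: normal_imp_subgroup)
  have HG: "h \<in> carrier G" if "h \<in> H" for h
    using subgroup.mem_carrier[OF H that] .
  have trans: "\<exists>h\<in>H. act h \<one>\<^bsub>N\<^esub> = x" if x: "x \<in> carrier N" for x
  proof -
    obtain g where g: "g \<in> carrier G" "act g \<one>\<^bsub>N\<^esub> = x"
      using unique_orbit x by blast
    then obtain h s where hs: "h \<in> H" "s \<in> ?S" "g = h \<otimes> s"
      using GHS unfolding set_mult_def by blast
    then have "act g \<one>\<^bsub>N\<^esub> = act h \<one>\<^bsub>N\<^esub>"
      using HG by (simp add: stabilizer_def composition_rule)
    with g(2) hs(1) show ?thesis by auto
  qed
  have gamma_one: "gamma N act h = \<one>\<^bsub>AutoGroup N\<^esub>" if h: "h \<in> H" for h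
    unfolding gamma_def one_AutoGroup
  proof (rule restrict_ext)
    fix x assume x: "x \<in> carrier N"
    obtain k where k: "k \<in> H" "act k \<one>\<^bsub>N\<^esub> = x"
      using trans x by blast
    then have "act h x = act h \<one>\<^bsub>N\<^esub> \<otimes>\<^bsub>N\<^esub> x"
      using mult[OF h k(1)] h HG by (simp add: composition_rule)
    then show "inv\<^bsub>N\<^esub> (act h \<one>\<^bsub>N\<^esub>) \<otimes>\<^bsub>N\<^esub> act h x = x"
      using x HG[OF h] by (simp add: act_closed N.m_assoc[symmetric])
  qed
  show ?thesis
  proof
    fix p assume "p \<in> Hol_N N"
    then obtain x where x: "x \<in> carrier N" "p = (x, \<one>\<^bsub>AutoGroup N\<^esub>)"
      by (auto simp: Hol_N_def)
    obtain h where h: "h \<in> H" "act h \<one>\<^bsub>N\<^esub> = x"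
      using trans x by blast
    then have "lambda_act N act h = p"
      using x gamma_one by (simp add: lambda_act_def)
    then show "p \<in> lambda_act N act ` carrier G"
      using HG h by blast
  qed
qed

end

text \<open>
  The complement is the kernel of \<open>\<gamma>\<close>. An element of it that fixes \<open>e\<close> acts as the translation by
  \<open>e\<close>, so it is trivial by faithfulness.
\<close>

lemma (in reduced_skew_bracoid) Hol_N_subset_imp_almost_classical:
  assumes sub: "Hol_N N \<subseteq> lambda_act N act ` carrier G"
  shows "almost_classical G N act"
proof -
  interpret G: group G by (rule group_G)
  let ?S = "stabilizer G act \<one>\<^bsub>N\<^esub>"
  define H where "H = kernel G (AutoGroup N) (gamma N act)"
  have HD: "h \<in> carrier G" "gamma N act h = \<one>\<^bsub>AutoGroup N\<^esub>" if "h \<in> H" for h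
    using that by (auto simp: H_def kernel_def)
  have S: "subgroup ?S G"
    by (rule stabilizer_subgroup) simp
  have H: "H \<lhd> G"
    unfolding H_def by (rule group_hom.normal_kernel[OF gamma_group_hom])
  have H_sub: "subgroup H G"
    using H by (rule normal_imp_subgroup)
  have "g \<in> H <#> ?S" if g: "g \<in> carrier G" for g
  proof -
    have "(act g \<one>\<^bsub>N\<^esub>, \<one>\<^bsub>AutoGroup N\<^esub>) \<in> Hol_N N"
      using g by (simp add: Hol_N_def act_closed)
    then have "(act g \<one>\<^bsub>N\<^esub>, \<one>\<^bsub>AutoGroup N\<^esub>) \<in> lambda_act N act ` carrier G"
      using sub by blast
    then obtain h where h: "h \<in> carrier G" "act h \<one>\<^bsub>N\<^esub> = act g \<one>\<^bsub>N\<^esub>" "gamma N act h = \<one>\<^bsub>AutoGroup N\<^esub>"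
      by (auto simp: lambda_act_def)
    then have "act (inv h \<otimes> g) \<one>\<^bsub>N\<^esub> = \<one>\<^bsub>N\<^esub>"
      using g orbit_sym_aux[OF h(1) _ h(2)] by (simp add: composition_rule)
    then have "inv h \<otimes> g \<in> ?S"
      using g h by (simp add: stabilizer_def)
    moreover have "h \<in> H"
      using h by (simp add: H_def kernel_def)
    moreover have "g = h \<otimes> (inv h \<otimes> g)"
      using g h by (simp add: G.m_assoc[symmetric])
    ultimately show ?thesis
      unfolding set_mult_def by blast
  qed
  then have GHS: "carrier G = H <#> ?S"
    using G.set_mult_closed[of H ?S] subgroup.subset[OF H_sub] subgroup.subset[OF S] by blast
  have "g = \<one>" if gH: "g \<in> H" and gS: "g \<in> ?S" for g
  proof -
    note g = HD[OF gH]
    have "act g x = act \<one> x" if x: "x \<in> carrier N" for x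
      using gamma_trivial_act[OF g x] gS x by (simp add: stabilizer_def id_eq_one[symmetric])
    then have "act g = act \<one>"
      using bij_prop0[OF g(1)] bij_prop0[OF G.one_closed]
      by (intro extensionalityI[of _ "carrier N"]) (auto dest: Bij_imp_extensional)
    then show ?thesis
      using faithful g by (auto dest: inj_onD)
  qed
  then have "H \<inter> ?S = {\<one>}"
    using subgroup.one_closed[OF H_sub] subgroup.one_closed[OF S] by blast
  moreover have "act h \<one>\<^bsub>N\<^esub> \<otimes>\<^bsub>N\<^esub> act k \<one>\<^bsub>N\<^esub> = act (h \<otimes> k) \<one>\<^bsub>N\<^esub>" if h: "h \<in> H" and k: "k \<in> H" for h k
    using gamma_trivial_act[OF HD[OF h], of "act k \<one>\<^bsub>N\<^esub>"] HD(1)[OF h] HD(1)[OF k]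
    by (simp add: composition_rule act_closed)
  ultimately show ?thesis
    unfolding almost_classical_def normal_complement_def using S H GHS by blast
qed

section \<open>The equivalence\<close>

theorem proposition4p3:
  fixes G :: "('a, 'c) monoid_scheme"
    and N :: "('b, 'd) monoid_scheme"
    and act :: "'a \<Rightarrow> 'b \<Rightarrow> 'b"
    and A :: "('b \<times> ('b \<Rightarrow> 'b)) set"
  assumes "reduced_skew_bracoid G N act"
    and "A = lambda_act N act ` carrier G"
  shows "((\<exists>B. subgroup B (AutoGroup N) \<and> is_N_semidirect N A B) \<longleftrightarrow> Hol_N N \<subseteq> A) \<and>
         (Hol_N N \<subseteq> A \<longleftrightarrow> almost_classical G N act)"
proof -
  interpret reduced_skew_bracoid G N act by (rule assms(1))
  have "subgroup A (Hol N)"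
    unfolding assms(2) by (rule group_hom.img_is_subgroup[OF lambda_act_group_hom])
  then show ?thesis
    using N.is_N_semidirect_iff almost_classical_imp_Hol_N_subset
      Hol_N_subset_imp_almost_classical assms(2) by blast
qed

end
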